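(* Let $Z_\bullet$ be a simplicial space satisfying the topological Kan condition. Then the diagonal simplicial set $D_\bullet=\operatorname{diag}(\operatorname{Sing}_\bullet Z_\bullet)$ is a Kan complex.
   Context: For a simplicial space $Z_\bullet$, $n\ge1$ and $0\le k\le n$, the space of $k$-horns of dimension $n$ is $$\Lambda^n_k(Z_\bullet)=\{(z_0,\dots,z_{k-1},-,z_{k+1},\dots,z_n)\mid d_i(z_j)=d_{j-1}(z_i),\ i<j,\ i\neq k\neq j\}\subset Z_{n-1}^{\,n}$$ with the subspace topology. The face maps $d_i$, $i\ne k$, induce $c^n_k\colon Z_n\to\Lambda^n_k(Z_\bullet)$. $Z_\bullet$ satisfies the topological Kan condition if $c^n_k$ is a surjective Serre fibration for all $n$ and all $0\le k\le n$. $\operatorname{Sing}_\bullet Z_\bullet$ is the bisimplicial set obtained by applying the singular simplicial set functor to each space $Z_q$. So an $n$-simplex of $D_\bullet$ is a continuous map $\Delta^n\to Z_n$ from the topological $n$-simplex. *)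

theory Defs
  imports "HOL-Homology.Homology"
begin

text \<open>
  All levels of a simplicial object share one element type; a sequence of sets or spaces living on
  different types is covered by taking a common sum type.  In the records below, \<open>sface n i\<close> is
  \<open>d\<^sub>i\<close> from level \<open>n\<close> to level \<open>n - 1\<close> (meaningful for \<open>1 \<le> n\<close>, \<open>i \<le> n\<close>) and \<open>sdegen n i\<close> is
  \<open>s\<^sub>i\<close> from level \<open>n\<close> to level \<open>n + 1\<close> (meaningful for \<open>i \<le> n\<close>).  Values outside these ranges are
  never constrained.
\<close>

record 'a sset =
  simplices :: "nat \<Rightarrow> 'a set"
  sface :: "nat \<Rightarrow> nat \<Rightarrow> 'a \<Rightarrow> 'a"
  sdegen :: "nat \<Rightarrow> nat \<Rightarrow> 'a \<Rightarrow> 'a"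

record 'a sspace =
  level :: "nat \<Rightarrow> 'a topology"
  face :: "nat \<Rightarrow> nat \<Rightarrow> 'a \<Rightarrow> 'a"
  degen :: "nat \<Rightarrow> nat \<Rightarrow> 'a \<Rightarrow> 'a"

definition simplicial_set :: "'a sset \<Rightarrow> bool" where
  "simplicial_set X \<longleftrightarrow>
     (\<forall>n i. 1 \<le> n \<longrightarrow> i \<le> n \<longrightarrow> sface X n i \<in> simplices X n \<rightarrow> simplices X (n - 1)) \<and>
     (\<forall>n i. i \<le> n \<longrightarrow> sdegen X n i \<in> simplices X n \<rightarrow> simplices X (n + 1)) \<and>
     (\<forall>n i j. \<forall>x \<in> simplices X n. 2 \<le> n \<longrightarrow> i < j \<longrightarrow> j \<le> n \<longrightarrow>
        sface X (n - 1) i (sface X n j x) = sface X (n - 1) (j - 1) (sface X n i x)) \<and>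
     (\<forall>n i j. \<forall>x \<in> simplices X n. i < j \<longrightarrow> j \<le> n \<longrightarrow>
        sface X (n + 1) i (sdegen X n j x) = sdegen X (n - 1) (j - 1) (sface X n i x)) \<and>
     (\<forall>n j. \<forall>x \<in> simplices X n. j \<le> n \<longrightarrow>
        sface X (n + 1) j (sdegen X n j x) = x \<and> sface X (n + 1) (j + 1) (sdegen X n j x) = x) \<and>
     (\<forall>n i j. \<forall>x \<in> simplices X n. j + 1 < i \<longrightarrow> i \<le> n + 1 \<longrightarrow>
        sface X (n + 1) i (sdegen X n j x) = sdegen X (n - 1) j (sface X n (i - 1) x)) \<and>
     (\<forall>n i j. \<forall>x \<in> simplices X n. i \<le> j \<longrightarrow> j \<le> n \<longrightarrow>
        sdegen X (n + 1) i (sdegen X n j x) = sdegen X (n + 1) (j + 1) (sdegen X n i x))"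

definition underlying_sset :: "'a sspace \<Rightarrow> 'a sset" where
  "underlying_sset Z =
     \<lparr>simplices = (\<lambda>n. topspace (level Z n)), sface = face Z, sdegen = degen Z\<rparr>"

definition simplicial_space :: "'a sspace \<Rightarrow> bool" where
  "simplicial_space Z \<longleftrightarrow>
     simplicial_set (underlying_sset Z) \<and>
     (\<forall>n i. 1 \<le> n \<longrightarrow> i \<le> n \<longrightarrow> continuous_map (level Z n) (level Z (n - 1)) (face Z n i)) \<and>
     (\<forall>n i. i \<le> n \<longrightarrow> continuous_map (level Z n) (level Z (n + 1)) (degen Z n i))"

definition horn_compatible ::
    "(nat \<Rightarrow> nat \<Rightarrow> 'a \<Rightarrow> 'a) \<Rightarrow> nat \<Rightarrow> nat \<Rightarrow> (nat \<Rightarrow> 'a) \<Rightarrow> bool" where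
  "horn_compatible d n k z \<longleftrightarrow>
     (\<forall>i j. i < j \<longrightarrow> j \<le> n \<longrightarrow> i \<noteq> k \<longrightarrow> j \<noteq> k \<longrightarrow> d (n - 1) i (z j) = d (n - 1) (j - 1) (z i))"

text \<open>
  A horn is a family indexed by \<open>{0..n} - {k}\<close> (extensional, i.e. \<open>undefined\<close> at \<open>k\<close> and beyond \<open>n\<close>).
\<close>

definition horn_map :: "(nat \<Rightarrow> nat \<Rightarrow> 'a \<Rightarrow> 'a) \<Rightarrow> nat \<Rightarrow> nat \<Rightarrow> 'a \<Rightarrow> nat \<Rightarrow> 'a" where
  "horn_map d n k z = (\<lambda>i \<in> {0..n} - {k}. d n i z)"

definition horn_space :: "'a sspace \<Rightarrow> nat \<Rightarrow> nat \<Rightarrow> (nat \<Rightarrow> 'a) topology" where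
  "horn_space Z n k =
     subtopology (product_topology (\<lambda>_. level Z (n - 1)) ({0..n} - {k}))
       {z. horn_compatible (face Z) n k z}"

definition horn_set :: "'a sset \<Rightarrow> nat \<Rightarrow> nat \<Rightarrow> (nat \<Rightarrow> 'a) set" where
  "horn_set X n k =
     {z \<in> ({0..n} - {k}) \<rightarrow>\<^sub>E simplices X (n - 1). horn_compatible (sface X) n k z}"

definition cube :: "nat \<Rightarrow> (nat \<Rightarrow> real) topology" where
  "cube m = product_topology (\<lambda>_. top_of_set {0..1}) {..<m}"

definition serre_fibration :: "'a topology \<Rightarrow> 'b topology \<Rightarrow> ('a \<Rightarrow> 'b) \<Rightarrow> bool" where
  "serre_fibration E B p \<longleftrightarrow>
     continuous_map E B p \<and>
     (\<forall>m f h.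
        continuous_map (cube m) E f \<longrightarrow>
        continuous_map (prod_topology (top_of_set {0..1::real}) (cube m)) B h \<longrightarrow>
        (\<forall>x \<in> topspace (cube m). h (0, x) = p (f x)) \<longrightarrow>
        (\<exists>g. continuous_map (prod_topology (top_of_set {0..1::real}) (cube m)) E g \<and>
             (\<forall>x \<in> topspace (cube m). g (0, x) = f x) \<and>
             (\<forall>t \<in> {0..1}. \<forall>x \<in> topspace (cube m). p (g (t, x)) = h (t, x))))"

definition topological_kan :: "'a sspace \<Rightarrow> bool" where
  "topological_kan Z \<longleftrightarrow>
     (\<forall>n k. 1 \<le> n \<longrightarrow> k \<le> n \<longrightarrow>
        horn_map (face Z) n k ` topspace (level Z n) = topspace (horn_space Z n k) \<and>
        serre_fibration (level Z n) (horn_space Z n k) (horn_map (face Z) n k))"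

definition kan_complex :: "'a sset \<Rightarrow> bool" where
  "kan_complex X \<longleftrightarrow>
     simplicial_set X \<and>
     (\<forall>n k. 1 \<le> n \<longrightarrow> k \<le> n \<longrightarrow>
        horn_map (sface X) n k ` simplices X n = horn_set X n k)"

text \<open>
  The codegeneracy \<open>\<Delta>\<^sup>p\<^sup>+\<^sup>1 \<rightarrow> \<Delta>\<^sup>p\<close> collapsing the vertices \<open>k\<close> and \<open>k + 1\<close>, complementing the library's
  coface \<^const>\<open>simplical_face\<close>.
\<close>

definition simplicial_degen :: "nat \<Rightarrow> (nat \<Rightarrow> real) \<Rightarrow> nat \<Rightarrow> real" where
  "simplicial_degen k x =
     (\<lambda>i. if i < k then x i else if i = k then x k + x (k + 1) else x (i + 1))"

definition singular_degen ::
    "nat \<Rightarrow> nat \<Rightarrow> ((nat \<Rightarrow> real) \<Rightarrow> 'a) \<Rightarrow> (nat \<Rightarrow> real) \<Rightarrow> 'a" where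
  "singular_degen p k f = restrict (f \<circ> simplicial_degen k) (standard_simplex (p + 1))"

definition Sing :: "'a topology \<Rightarrow> ((nat \<Rightarrow> real) \<Rightarrow> 'a) sset" where
  "Sing T =
     \<lparr>simplices = (\<lambda>p. singular_simplex_set p T), sface = singular_face, sdegen = singular_degen\<rparr>"

text \<open>
  Bidegree \<open>(p, q)\<close>: the horizontal operators \<open>hface p q i\<close>, \<open>hdegen p q i\<close> change \<open>p\<close>, the vertical
  ones \<open>vface p q i\<close>, \<open>vdegen p q i\<close> change \<open>q\<close>; \<open>(p, q)\<close> is always the bidegree of the source.
\<close>

record 'a bisset =
  bisimplices :: "nat \<Rightarrow> nat \<Rightarrow> 'a set"
  hface :: "nat \<Rightarrow> nat \<Rightarrow> nat \<Rightarrow> 'a \<Rightarrow> 'a"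
  hdegen :: "nat \<Rightarrow> nat \<Rightarrow> nat \<Rightarrow> 'a \<Rightarrow> 'a"
  vface :: "nat \<Rightarrow> nat \<Rightarrow> nat \<Rightarrow> 'a \<Rightarrow> 'a"
  vdegen :: "nat \<Rightarrow> nat \<Rightarrow> nat \<Rightarrow> 'a \<Rightarrow> 'a"

definition Sing_levelwise :: "'a sspace \<Rightarrow> ((nat \<Rightarrow> real) \<Rightarrow> 'a) bisset" where
  "Sing_levelwise Z =
     \<lparr>bisimplices = (\<lambda>p q. simplices (Sing (level Z q)) p),
      hface = (\<lambda>p q. sface (Sing (level Z q)) p),
      hdegen = (\<lambda>p q. sdegen (Sing (level Z q)) p),
      vface = (\<lambda>p q i. simplex_map p (face Z q i)),
      vdegen = (\<lambda>p q i. simplex_map p (degen Z q i))\<rparr>"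

definition diag :: "'a bisset \<Rightarrow> 'a sset" where
  "diag B =
     \<lparr>simplices = (\<lambda>n. bisimplices B n n),
      sface = (\<lambda>n i. hface B n (n - 1) i \<circ> vface B n n i),
      sdegen = (\<lambda>n i. hdegen B n (n + 1) i \<circ> vdegen B n n i)\<rparr>"

end

theory Submission
  imports Defs "HOL-Analysis.Ordered_Euclidean_Space"
begin

text \<open>
  A horn in the diagonal prescribes \<open>d\<^sub>i \<sigma>\<close> on the \<open>i\<close>-th face of the topological simplex, \<open>i \<noteq> k\<close>.
  The simplex is a retract of the cube by a map preserving the vanishing of the coordinates
  \<open>i \<noteq> k\<close>, so one may work on a cube, with the faces \<open>{x. x i = 0}\<close> in place of those of the
  simplex.  There one proves more: if compatible maps \<open>s\<^sub>i\<close> into \<open>Z\<^sub>m\<^sub>-\<^sub>1\<close> are given on unions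
  \<open>D i\<close> of coordinate faces, and \<open>\<sigma>\<close> itself on such a union \<open>B\<close>, then \<open>\<sigma>\<close> exists on the whole
  cube.  If every \<open>D i\<close> is the whole cube, the \<open>s\<^sub>i\<close> form a map into the horn space, which lifts
  because the pair (cube, \<open>B\<close>) has the relative lifting property for surjective Serre fibrations.
  Otherwise some \<open>s\<^sub>j\<close> has to be extended to the whole cube, with its faces
  prescribed by the other \<open>s\<^sub>i\<close> and its values on \<open>B\<close> by \<open>d\<^sub>j \<sigma>\<close>; that is the same problem in
  dimension \<open>m - 1\<close>.
\<close>

section \<open>The diagonal as a simplicial set\<close>

lemma simplical_face_face:
  "i < j \<Longrightarrow> simplical_face j (simplical_face i t) = simplical_face i (simplical_face (j - 1) t)"
  for t :: "nat \<Rightarrow> real"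
  by (auto simp: simplical_face_def fun_eq_iff)

lemma simplicial_degen_face_less:
  "i < j \<Longrightarrow> simplicial_degen j (simplical_face i t) = simplical_face i (simplicial_degen (j - 1) t)"
  by (auto simp: simplical_face_def simplicial_degen_def fun_eq_iff)

lemma simplicial_degen_face_same: "simplicial_degen j (simplical_face j t) = t"
  by (auto simp: simplical_face_def simplicial_degen_def fun_eq_iff)

lemma simplicial_degen_face_Suc: "simplicial_degen j (simplical_face (Suc j) t) = t"
  by (auto simp: simplical_face_def simplicial_degen_def fun_eq_iff)

lemma simplicial_degen_face_greater:
  "Suc j < i \<Longrightarrow>
    simplicial_degen j (simplical_face i t) = simplical_face (i - 1) (simplicial_degen j t)"
  by (auto simp: simplical_face_def simplicial_degen_def fun_eq_iff)

lemma simplicial_degen_degen: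
  "i \<le> j \<Longrightarrow>
    simplicial_degen j (simplicial_degen i t) = simplicial_degen i (simplicial_degen (Suc j) t)"
  by (auto simp: simplicial_degen_def fun_eq_iff)

text \<open>Collapsing adds two adjacent coordinates, so the total is unchanged. In the inductive
  step \<open>k = Suc p\<close> is separate: there the merged entry is the last one and all earlier
  coordinates are untouched.\<close>

lemma sum_simplicial_degen:
  "k \<le> p \<Longrightarrow> (\<Sum>i\<le>p. simplicial_degen k x i) = (\<Sum>i\<le>Suc p. x i)"
proof (induction p)
  case 0
  then show ?case by (simp add: simplicial_degen_def)
next
  case (Suc p)
  show ?case
  proof (cases "k \<le> p")
    case True
    then show ?thesis using Suc.IH by (simp add: simplicial_degen_def)
  next
    case False
    then have "k = Suc p" using Suc.prems by simp
    then have "(\<Sum>i\<le>p. simplicial_degen k x i) = (\<Sum>i\<le>p. x i)"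
      by (intro sum.cong) (auto simp: simplicial_degen_def)
    then show ?thesis using \<open>k = Suc p\<close> by (simp add: simplicial_degen_def)
  qed
qed

lemma simplicial_degen_in_standard_simplex:
  assumes "k \<le> p" and x: "x \<in> standard_simplex (Suc p)"
  shows "simplicial_degen k x \<in> standard_simplex p"
proof -
  have s: "(\<Sum>i\<le>p. simplicial_degen k x i) = 1"
    using sum_simplicial_degen[OF assms(1), of x] x by (simp add: standard_simplex_def)
  have nn: "0 \<le> simplicial_degen k x i" for i
    using x by (auto simp: standard_simplex_def simplicial_degen_def)
  have z: "simplicial_degen k x i = 0" if "i > p" for i
    using x that assms(1) by (auto simp: standard_simplex_def simplicial_degen_def)
  \<comment> \<open>The bound by 1 in \<open>standard_simplex\<close> follows from nonnegativity and
    total 1.\<close>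
  have "simplicial_degen k x i \<le> 1" for i
  proof (cases "i \<le> p")
    case True
    then show ?thesis
      using member_le_sum[of i "{..p}" "simplicial_degen k x"] nn s by auto
  next
    case False
    then show ?thesis using z by simp
  qed
  then show ?thesis using s nn z by (auto simp: standard_simplex_def)
qed

lemma continuous_map_simplicial_degen:
  "continuous_map (powertop_real UNIV) (powertop_real UNIV) (simplicial_degen k)"
proof (clarsimp simp: continuous_map_componentwise)
  fix i
  have "continuous_map (powertop_real UNIV) euclideanreal
          (\<lambda>x. if i < k then x i else if i = k then x k + x (k + 1) else x (i + 1))"
    by (auto intro!: continuous_map_product_projection continuous_map_add)
  then show "continuous_map (powertop_real UNIV) euclideanreal (\<lambda>x. simplicial_degen k x i)"
    by (simp add: simplicial_degen_def)
qed

lemma singular_simplex_singular_degen: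
  assumes f: "singular_simplex p X f" and "k \<le> p"
  shows "singular_simplex (p + 1) X (singular_degen p k f)"
proof -
  let ?PT = "powertop_real UNIV"
  have "continuous_map (subtopology ?PT (standard_simplex (p + 1)))
          (subtopology ?PT (standard_simplex p)) (simplicial_degen k)"
    using continuous_map_simplicial_degen assms(2)
    by (simp add: continuous_map_in_subtopology continuous_map_from_subtopology
        simplicial_degen_in_standard_simplex Pi_iff)
  moreover have "continuous_map (subtopology ?PT (standard_simplex p)) X f"
    using f singular_simplex_def by blast
  ultimately show ?thesis
    by (simp add: singular_simplex_def singular_degen_def continuous_map_compose)
qed

section \<open>Simplicial identities of \<open>Z\<close>, and the operators of the diagonal in
  closed form\<close>

lemma sspace_face_face:
  assumes "simplicial_space Z" "2 \<le> n" "i < j" "j \<le> n" "x \<in> topspace (level Z n)"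
  shows "face Z (n - 1) i (face Z n j x) = face Z (n - 1) (j - 1) (face Z n i x)"
  using assms by (simp add: simplicial_space_def simplicial_set_def underlying_sset_def)

lemma sspace_face_degen_less:
  assumes "simplicial_space Z" "i < j" "j \<le> n" "x \<in> topspace (level Z n)"
  shows "face Z (n + 1) i (degen Z n j x) = degen Z (n - 1) (j - 1) (face Z n i x)"
  using assms by (simp add: simplicial_space_def simplicial_set_def underlying_sset_def)

lemma sspace_face_degen_same:
  assumes "simplicial_space Z" "j \<le> n" "x \<in> topspace (level Z n)"
  shows "face Z (n + 1) j (degen Z n j x) = x" "face Z (n + 1) (j + 1) (degen Z n j x) = x"
  using assms by (simp_all add: simplicial_space_def simplicial_set_def underlying_sset_def)

lemma sspace_face_degen_greater:
  assumes "simplicial_space Z" "j + 1 < i" "i \<le> n + 1" "x \<in> topspace (level Z n)"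
  shows "face Z (n + 1) i (degen Z n j x) = degen Z (n - 1) j (face Z n (i - 1) x)"
  using assms by (simp add: simplicial_space_def simplicial_set_def underlying_sset_def)

lemma sspace_degen_degen:
  assumes "simplicial_space Z" "i \<le> j" "j \<le> n" "x \<in> topspace (level Z n)"
  shows "degen Z (n + 1) i (degen Z n j x) = degen Z (n + 1) (j + 1) (degen Z n i x)"
  using assms by (simp add: simplicial_space_def simplicial_set_def underlying_sset_def)

lemma simplices_diag_Sing [simp]:
  "simplices (diag (Sing_levelwise Z)) n = singular_simplex_set n (level Z n)"
  by (simp add: diag_def Sing_levelwise_def Sing_def)

text \<open>The vertical face acts on values and the horizontal one on arguments. In this form an
  identity in the diagonal can be checked at one point of the simplex at a time.\<close>

lemma sface_diag_Sing:
  assumes "1 \<le> n" "i \<le> n"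
  shows "sface (diag (Sing_levelwise Z)) n i x =
    (\<lambda>t\<in>standard_simplex (n - 1). face Z n i (x (simplical_face i t)))"
  using assms
  by (auto simp: diag_def Sing_levelwise_def Sing_def singular_face_def simplex_map_def
      simplical_face_in_standard_simplex)

lemma sdegen_diag_Sing:
  assumes "i \<le> n"
  shows "sdegen (diag (Sing_levelwise Z)) n i x =
    (\<lambda>t\<in>standard_simplex (n + 1). degen Z n i (x (simplicial_degen i t)))"
  using assms
  by (auto simp: diag_def Sing_levelwise_def Sing_def singular_degen_def simplex_map_def
      simplicial_degen_in_standard_simplex)

lemma singular_simplex_in_topspace:
  "singular_simplex n X x \<Longrightarrow> t \<in> standard_simplex n \<Longrightarrow> x t \<in> topspace X"
  by (auto simp: singular_simplex_def continuous_map_def)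

text \<open>Each identity splits at a point \<open>t\<close>: the cosimplicial identity matches the
  arguments of \<open>x\<close>, and the simplicial identity of \<open>Z\<close> applies to the
  value there. The auxiliary membership facts open the \<open>restrict\<close> wrappers.\<close>

lemma simplicial_set_diag_Sing:
  assumes Z: "simplicial_space Z"
  shows "simplicial_set (diag (Sing_levelwise Z))"
proof -
  let ?D = "diag (Sing_levelwise Z)"
  have cf: "continuous_map (level Z n) (level Z (n - 1)) (face Z n i)" if "1 \<le> n" "i \<le> n" for n i
    using Z that by (simp add: simplicial_space_def)
  have cd: "continuous_map (level Z n) (level Z (n + 1)) (degen Z n i)" if "i \<le> n" for n i
    using Z that by (simp add: simplicial_space_def)
  have 1: "sface ?D n i x \<in> simplices ?D (n - 1)" if "1 \<le> n" "i \<le> n" "x \<in> simplices ?D n" for n i x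
    using that cf
      singular_simplex_singular_face[OF singular_simplex_simplex_map[where p = n and g = "face Z n i"]]
    by (simp add: diag_def Sing_levelwise_def Sing_def)
  have 2: "sdegen ?D n i x \<in> simplices ?D (n + 1)" if "i \<le> n" "x \<in> simplices ?D n" for n i x
    using that cd
      singular_simplex_singular_degen[OF singular_simplex_simplex_map[where p = n and g = "degen Z n i"]]
    by (simp add: diag_def Sing_levelwise_def Sing_def)
  have ff: "sface ?D (n - 1) i (sface ?D n j x) = sface ?D (n - 1) (j - 1) (sface ?D n i x)"
    if "x \<in> simplices ?D n" "2 \<le> n" "i < j" "j \<le> n" for n i j x
  proof -
    have "face Z (n - 1) i (face Z n j (x (simplical_face j (simplical_face i t)))) =
       face Z (n - 1) (j - 1) (face Z n i (x (simplical_face i (simplical_face (j - 1) t))))"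
      if t: "t \<in> standard_simplex (n - 2)" for t
    proof -
      have "simplical_face (j - 1) t \<in> standard_simplex (n - 1)"
        using \<open>2 \<le> n\<close> \<open>j \<le> n\<close> t
        by (intro simplical_face_in_standard_simplex) (auto simp: numeral_2_eq_2)
      then have "simplical_face i (simplical_face (j - 1) t) \<in> standard_simplex n"
        using \<open>2 \<le> n\<close> \<open>i < j\<close> \<open>j \<le> n\<close>
        by (simp add: simplical_face_in_standard_simplex)
      then show ?thesis
        using sspace_face_face[OF Z \<open>2 \<le> n\<close> \<open>i < j\<close> \<open>j \<le> n\<close>] that \<open>x \<in> simplices ?D n\<close>
        by (simp add: simplical_face_face[OF \<open>i < j\<close>] singular_simplex_in_topspace)
    qed
    then show ?thesis
      using that
      by (auto simp: sface_diag_Sing fun_eq_iff restrict_def simplical_face_in_standard_simplex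
          numeral_2_eq_2)
  qed
  have mem: "simplicial_degen j t \<in> standard_simplex (n - 1)"
    if "t \<in> standard_simplex n" "j < n" for j n t
    using simplicial_degen_in_standard_simplex[of j "n - 1" t] that by simp
  have fd1: "sface ?D (n + 1) i (sdegen ?D n j x) = sdegen ?D (n - 1) (j - 1) (sface ?D n i x)"
    if x: "x \<in> simplices ?D n" and ij: "i < j" "j \<le> n" for n i j x
  proof -
    have u: "simplicial_degen (j - 1) t \<in> standard_simplex (n - 1)" if "t \<in> standard_simplex n" for t
      using that ij by (intro mem) auto
    have "face Z (n + 1) i (degen Z n j (x (simplical_face i (simplicial_degen (j - 1) t)))) =
       degen Z (n - 1) (j - 1) (face Z n i (x (simplical_face i (simplicial_degen (j - 1) t))))"
      if t: "t \<in> standard_simplex n" for t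
    proof -
      have "simplical_face i (simplicial_degen (j - 1) t) \<in> standard_simplex n"
        using u[OF t] ij by (intro simplical_face_in_standard_simplex) auto
      then show ?thesis using sspace_face_degen_less[OF Z ij] x
        by (simp add: singular_simplex_in_topspace)
    qed
    then show ?thesis using ij u
      by (auto simp: sface_diag_Sing sdegen_diag_Sing fun_eq_iff restrict_def
        simplicial_degen_face_less simplical_face_in_standard_simplex)
  qed
  \<comment> \<open>The next identity returns \<open>x\<close> itself, so both sides must also agree
    off the simplex, where singular simplices are \<open>undefined\<close>.\<close>
  have x_undef: "x t = undefined" if "singular_simplex n X x" "t \<notin> standard_simplex n" for n X x t
    using that by (auto simp: singular_simplex_def extensional_def)
  have fd2: "sface ?D (n + 1) j (sdegen ?D n j x) = x \<and>
    sface ?D (n + 1) (j + 1) (sdegen ?D n j x) = x"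
    if x: "x \<in> simplices ?D n" and j: "j \<le> n" for n j x
    using x j sspace_face_degen_same[OF Z j]
    by (auto simp: sface_diag_Sing sdegen_diag_Sing fun_eq_iff restrict_def
        simplicial_degen_face_same simplicial_degen_face_Suc simplical_face_in_standard_simplex
        singular_simplex_in_topspace x_undef)
  have fd3: "sface ?D (n + 1) i (sdegen ?D n j x) = sdegen ?D (n - 1) j (sface ?D n (i - 1) x)"
    if x: "x \<in> simplices ?D n" and ij: "j + 1 < i" "i \<le> n + 1" for n i j x
  proof -
    have u: "simplicial_degen j t \<in> standard_simplex (n - 1)" if "t \<in> standard_simplex n" for t
      using that ij by (intro mem) auto
    have "face Z (n + 1) i (degen Z n j (x (simplical_face (i - 1) (simplicial_degen j t)))) =
       degen Z (n - 1) j (face Z n (i - 1) (x (simplical_face (i - 1) (simplicial_degen j t))))"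
      if t: "t \<in> standard_simplex n" for t
    proof -
      have "simplical_face (i - 1) (simplicial_degen j t) \<in> standard_simplex n"
        using u[OF t] ij by (intro simplical_face_in_standard_simplex) auto
      then show ?thesis using sspace_face_degen_greater[OF Z ij] x
        by (simp add: singular_simplex_in_topspace)
    qed
    then show ?thesis using ij u
      by (auto simp: sface_diag_Sing sdegen_diag_Sing fun_eq_iff restrict_def
        simplicial_degen_face_greater simplical_face_in_standard_simplex)
  qed
  have dd: "sdegen ?D (n + 1) i (sdegen ?D n j x) = sdegen ?D (n + 1) (j + 1) (sdegen ?D n i x)"
    if x: "x \<in> simplices ?D n" and ij: "i \<le> j" "j \<le> n" for n i j x
  proof -
    have u: "simplicial_degen (Suc j) t \<in> standard_simplex (Suc n)"
      if "t \<in> standard_simplex (Suc (Suc n))" for t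
      using that ij by (intro simplicial_degen_in_standard_simplex) auto
    have "degen Z (n + 1) i (degen Z n j (x (simplicial_degen i (simplicial_degen (Suc j) t)))) =
       degen Z (n + 1) (j + 1) (degen Z n i (x (simplicial_degen i (simplicial_degen (Suc j) t))))"
      if t: "t \<in> standard_simplex (Suc (Suc n))" for t
    proof -
      have "simplicial_degen i (simplicial_degen (Suc j) t) \<in> standard_simplex n"
        using u[OF t] ij by (simp add: simplicial_degen_in_standard_simplex)
      then show ?thesis using sspace_degen_degen[OF Z ij] x
        by (simp add: singular_simplex_in_topspace)
    qed
    then show ?thesis using ij u
      by (auto simp: sdegen_diag_Sing fun_eq_iff restrict_def
        simplicial_degen_degen simplicial_degen_in_standard_simplex)
  qed
  show ?thesis
    unfolding simplicial_set_def
    by (intro conjI allI impI ballI Pi_I)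
      (rule 1 2 ff fd1 fd2[THEN conjunct1] fd2[THEN conjunct2] fd3 dd; assumption)+
qed

section \<open>Relative lifting over a cube\<close>

lemma topspace_cube: "topspace (cube N) = {..<N} \<rightarrow>\<^sub>E {0..1}"
  by (simp add: cube_def)

lemma in_topspace_cube: "x \<in> topspace (cube N) \<longleftrightarrow> (\<forall>i<N. x i \<in> {0..1}) \<and> x \<in> extensional {..<N}"
  by (auto simp: topspace_cube PiE_iff)

lemma continuous_map_cube_coord:
  "i < N \<Longrightarrow> continuous_map (cube N) euclideanreal (\<lambda>x. x i)"
  unfolding cube_def
  using continuous_map_into_fulltopology[OF continuous_map_product_projection[of i "{..<N}" "\<lambda>_. top_of_set {0..1::real}"]]
  by simp

lemma continuous_map_into_cube:
  assumes "\<And>i. i < N \<Longrightarrow> continuous_map X euclideanreal (\<lambda>x. f x i)"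
    and "f \<in> topspace X \<rightarrow> topspace (cube N)"
  shows "continuous_map X (cube N) f"
  using assms
  by (auto simp: cube_def continuous_map_componentwise continuous_map_in_subtopology Pi_iff PiE_iff)

text \<open>Lift the homotopy \<open>h \<circ> H\<close> from the initial map \<open>f\<close> to
  some \<open>G\<close> and read it off along the graph of \<open>\<phi>\<close>, as
  \<open>G (\<phi> y, y)\<close>. There \<open>H\<close> returns \<open>y\<close>, which makes this
  a lift of \<open>h\<close>; where \<open>\<phi>\<close> vanishes, it is the initial value
  \<open>f y\<close>.\<close>

lemma serre_fibration_lift:
  assumes p: "serre_fibration E B p"
    and h: "continuous_map (cube N) B h"
    and f: "continuous_map (cube N) E f"
    and H: "continuous_map (prod_topology (top_of_set {0..1::real}) (cube N)) (cube N) H"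
    and phi: "continuous_map (cube N) (top_of_set {0..1}) \<phi>"
    and H0: "\<And>y. y \<in> topspace (cube N) \<Longrightarrow> p (f y) = h (H (0, y))"
    and H1: "\<And>y. y \<in> topspace (cube N) \<Longrightarrow> H (\<phi> y, y) = y"
  obtains g where "continuous_map (cube N) E g"
    and "\<And>y. y \<in> topspace (cube N) \<Longrightarrow> p (g y) = h y"
    and "\<And>y. y \<in> topspace (cube N) \<Longrightarrow> \<phi> y = 0 \<Longrightarrow> g y = f y"
proof -
  have "continuous_map (prod_topology (top_of_set {0..1::real}) (cube N)) B (h \<circ> H)"
    using H h by (rule continuous_map_compose)
  moreover have "\<forall>x\<in>topspace (cube N). (h \<circ> H) (0, x) = p (f x)"
    using H0 by simp
  ultimately obtain G
    where G: "continuous_map (prod_topology (top_of_set {0..1::real}) (cube N)) E G"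
      "\<forall>x\<in>topspace (cube N). G (0, x) = f x"
      "\<forall>t\<in>{0..1}. \<forall>x\<in>topspace (cube N). p (G (t, x)) = (h \<circ> H) (t, x)"
    using p[unfolded serre_fibration_def, THEN conjunct2, rule_format, OF f, of "h \<circ> H"] by auto
  have ph: "\<phi> y \<in> {0..1}" if "y \<in> topspace (cube N)" for y
    using phi that by (auto simp: continuous_map_def)
  show thesis
  proof
    have "continuous_map (cube N) (prod_topology (top_of_set {0..1::real}) (cube N)) (\<lambda>y. (\<phi> y, y))"
      using phi by (intro continuous_map_pairedI) auto
    from continuous_map_compose[OF this G(1)]
    show "continuous_map (cube N) E (\<lambda>y. G (\<phi> y, y))" by (simp add: o_def)
  next
    fix y assume y: "y \<in> topspace (cube N)"
    show "p (G (\<phi> y, y)) = h y"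
      using bspec[OF bspec[OF G(3) ph[OF y]] y] H1[OF y] by simp
    show "G (\<phi> y, y) = f y" if "\<phi> y = 0"
      using G(2) y that by simp
  qed
qed

section \<open>Unions of coordinate faces of the cube\<close>

definition cube_faces :: "nat \<Rightarrow> nat set \<Rightarrow> (nat \<Rightarrow> real) set" where
  "cube_faces N S = {x \<in> topspace (cube N). \<exists>a\<in>S. x a = 0}"

text \<open>This class is closed under unions, so \<open>D j \<union> B\<close> can serve as a base
  again in the induction. \<open>S = {}\<close> gives the empty set, over which nothing is
  prescribed.\<close>

definition cube_piece :: "nat \<Rightarrow> (nat \<Rightarrow> real) set \<Rightarrow> bool" where
  "cube_piece N A \<longleftrightarrow> A = topspace (cube N) \<or> (\<exists>S\<subseteq>{..<N}. A = cube_faces N S)"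

lemma cube_piece_subset: "cube_piece N A \<Longrightarrow> A \<subseteq> topspace (cube N)"
  by (auto simp: cube_piece_def cube_faces_def)

lemma cube_piece_Un:
  assumes "cube_piece N A" "cube_piece N B"
  shows "cube_piece N (A \<union> B)"
proof (cases "A = topspace (cube N) \<or> B = topspace (cube N)")
  case True
  then have "A \<union> B = topspace (cube N)"
    using cube_piece_subset[OF assms(1)] cube_piece_subset[OF assms(2)] by blast
  then show ?thesis by (simp add: cube_piece_def)
next
  case False
  then obtain S T where "S \<subseteq> {..<N}" "T \<subseteq> {..<N}" "A = cube_faces N S" "B = cube_faces N T"
    using assms by (auto simp: cube_piece_def)
  then have "A \<union> B = cube_faces N (S \<union> T)" "S \<union> T \<subseteq> {..<N}"
    by (auto simp: cube_faces_def)
  then show ?thesis unfolding cube_piece_def by blast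
qed

lemma closedin_cube_piece:
  assumes "cube_piece N A"
  shows "closedin (cube N) A"
proof (cases "A = topspace (cube N)")
  case False
  then obtain S where S: "S \<subseteq> {..<N}" "A = cube_faces N S"
    using assms by (auto simp: cube_piece_def)
  have "closedin (cube N) (\<Union>a\<in>S. {x \<in> topspace (cube N). x a \<in> {0}})"
  proof (rule closedin_Union)
    show "finite ((\<lambda>a. {x \<in> topspace (cube N). x a \<in> {0}}) ` S)"
      using S(1) finite_subset by blast
    show "closedin (cube N) T" if "T \<in> (\<lambda>a. {x \<in> topspace (cube N). x a \<in> {0}}) ` S" for T
      using that S(1)
      by (auto intro!: closedin_continuous_map_preimage[OF continuous_map_cube_coord, of _ _ "{0}", simplified])
  qed
  moreover have "(\<Union>a\<in>S. {x \<in> topspace (cube N). x a \<in> {0}}) = A"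
    by (auto simp: S cube_faces_def)
  ultimately show ?thesis by simp
qed simp

text \<open>
  \<open>H\<close> flows the coordinates in \<open>S\<close> simultaneously and starts on the faces; the point \<open>y\<close> lies on its
  own flow line at time \<open>\<phi> y = Min (y ` S)\<close>.  Lifting the flow and evaluating at that time solves the
  relative lifting problem without any homeomorphism of pairs.
\<close>

lemma cube_faces_deformation:
  assumes S: "S \<subseteq> {..<N}" "S \<noteq> {}"
  obtains \<phi> H where "continuous_map (cube N) (top_of_set {0..1}) \<phi>"
    and "continuous_map (prod_topology (top_of_set {0..1::real}) (cube N)) (cube N) H"
    and "\<And>y. y \<in> topspace (cube N) \<Longrightarrow> H (0, y) \<in> cube_faces N S"
    and "\<And>y. y \<in> topspace (cube N) \<Longrightarrow> H (\<phi> y, y) = y"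
    and "\<And>y. y \<in> cube_faces N S \<Longrightarrow> \<phi> y = 0"
proof -
  \<comment> \<open>Written as an infimum so that continuity comes from
    \<open>continuous_map_Inf\<close>; pointwise it is the minimum over the finite set
    \<open>S\<close>.\<close>
  define \<phi> :: "(nat \<Rightarrow> real) \<Rightarrow> real" where "\<phi> y = (INF a\<in>S. y a)" for y
  \<comment> \<open>Truncation at 1 keeps the flow inside the cube. At time 0 a coordinate attaining
    the minimum becomes 0; at time \<open>\<phi> y\<close> each coordinate is back at
    \<open>y a \<le> 1\<close>, where truncation has no effect.\<close>
  define H :: "real \<times> (nat \<Rightarrow> real) \<Rightarrow> nat \<Rightarrow> real"
    where "H = (\<lambda>(t, y). \<lambda>a\<in>{..<N}. if a \<in> S then min 1 (y a - \<phi> y + t) else y a)"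
  let ?P = "prod_topology (top_of_set {0..1::real}) (cube N)"
  have fin: "finite S" using S(1) finite_subset by blast
  have Min: "\<phi> y = Min (y ` S)" for y
    using fin S(2) by (simp add: \<phi>_def cInf_eq_Min)
  have le: "\<phi> y \<le> y a" if "a \<in> S" for y a
    using that fin by (simp add: Min)
  have att: "\<exists>a\<in>S. \<phi> y = y a" for y
  proof -
    have "Min (y ` S) \<in> y ` S" using fin S(2) by simp
    then show ?thesis unfolding Min by blast
  qed
  have I: "y a \<in> {0..1}" if "y \<in> topspace (cube N)" "a < N" for y a
    using that in_topspace_cube by blast
  have phi01: "\<phi> y \<in> {0..1}" if "y \<in> topspace (cube N)" for y
  proof -
    obtain a where "a \<in> S" "\<phi> y = y a" using att[of y] by blast
    moreover have "y a \<in> {0..1}"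
      by (rule I[OF that]) (use \<open>a \<in> S\<close> S(1) in blast)
    ultimately show ?thesis by (simp only:)
  qed
  have cphi: "continuous_map (cube N) euclideanreal \<phi>"
    unfolding \<phi>_def using fin S(1)
    by (intro continuous_map_Inf continuous_map_cube_coord) auto
  have Hmem: "H (t, y) \<in> topspace (cube N)" if "t \<in> {0..1}" "y \<in> topspace (cube N)" for t y
  proof -
    have "min 1 (y a - \<phi> y + t) \<in> {0..1}" if "a \<in> S" for a
      using le[OF that, of y] \<open>t \<in> {0..1}\<close> by auto
    then have "H (t, y) a \<in> {0..1}" if "a < N" for a
      using I[OF \<open>y \<in> topspace (cube N)\<close> that] that by (cases "a \<in> S") (simp_all add: H_def)
    then show ?thesis
      by (simp add: in_topspace_cube) (simp add: H_def)
  qed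
  show thesis
  proof
    show "continuous_map (cube N) (top_of_set {0..1}) \<phi>"
      using cphi phi01 by (simp add: continuous_map_in_subtopology)
    show "continuous_map ?P (cube N) H"
    proof (rule continuous_map_into_cube)
      show "H \<in> topspace ?P \<rightarrow> topspace (cube N)"
        by (simp add: Pi_iff Hmem)
      fix i assume i: "i < N"
      have c1: "continuous_map ?P euclideanreal (\<lambda>z. snd z i)"
        using continuous_map_compose[OF continuous_map_snd continuous_map_cube_coord[OF i]]
        by (simp add: o_def)
      have c2: "continuous_map ?P euclideanreal (\<lambda>z. \<phi> (snd z))"
        using continuous_map_compose[OF continuous_map_snd cphi] by (simp add: o_def)
      have c3: "continuous_map ?P euclideanreal fst"
        using continuous_map_into_fulltopology[OF continuous_map_fst] .
      show "continuous_map ?P euclideanreal (\<lambda>z. H z i)"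
      proof (cases "i \<in> S")
        case True
        then have "(\<lambda>z. H z i) = (\<lambda>z. min 1 (snd z i - \<phi> (snd z) + fst z))"
          using i by (auto simp: H_def fun_eq_iff)
        then show ?thesis
          using c1 c2 c3
          by (simp add: continuous_map_real_min continuous_map_add continuous_map_diff)
      next
        case False
        then have "(\<lambda>z. H z i) = (\<lambda>z. snd z i)"
          using i by (auto simp: H_def fun_eq_iff)
        then show ?thesis using c1 by simp
      qed
    qed
  next
    fix y assume y: "y \<in> topspace (cube N)"
    obtain a where a: "a \<in> S" "\<phi> y = y a" using att[of y] by blast
    then have "H (0, y) a = 0" using S(1) by (auto simp: H_def)
    then show "H (0, y) \<in> cube_faces N S"
      using a(1) Hmem[of 0 y] y by (auto simp: cube_faces_def)
    show "H (\<phi> y, y) = y"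
    proof
      fix b
      show "H (\<phi> y, y) b = y b"
        using I[OF y, of b] y by (cases "b < N") (auto simp: H_def in_topspace_cube extensional_def)
    qed
  next
    fix y assume y: "y \<in> cube_faces N S"
    then obtain a where "a \<in> S" "y a = 0" by (auto simp: cube_faces_def)
    then have "\<phi> y \<le> 0" using le[of a y] by simp
    then show "\<phi> y = 0" using phi01[of y] y by (auto simp: cube_faces_def)
  qed
qed

text \<open>Over the whole cube \<open>f\<close> is already the lift. Over a nonempty union of
  faces, lift the flow that starts on the faces. Over the empty set, surjectivity supplies a point
  above one corner, and a contraction of the cube to that corner is lifted.\<close>

lemma serre_fibration_pair_lift:
  assumes p: "serre_fibration E B p" and surj: "p ` topspace E = topspace B"
    and A: "cube_piece N A"
    and f: "continuous_map (subtopology (cube N) A) E f"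
    and h: "continuous_map (cube N) B h"
    and pf: "\<And>x. x \<in> A \<Longrightarrow> p (f x) = h x"
  obtains g where "continuous_map (cube N) E g"
    and "\<And>x. x \<in> topspace (cube N) \<Longrightarrow> p (g x) = h x"
    and "\<And>x. x \<in> A \<Longrightarrow> g x = f x"
proof -
  consider "A = topspace (cube N)"
    | "A = {}"
    | S where "S \<subseteq> {..<N}" "S \<noteq> {}" "A = cube_faces N S"
    using A by (auto simp: cube_piece_def cube_faces_def)
  then show thesis
  proof cases
    case 1
    then show ?thesis using that[of f] f pf by simp
  next
    case 2
    define c :: "nat \<Rightarrow> real" where "c = (\<lambda>a\<in>{..<N}. 0)"
    have c: "c \<in> topspace (cube N)" by (auto simp: c_def topspace_cube)
    then have "h c \<in> topspace B" using h by (auto simp: continuous_map_def)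
    then obtain e where e: "e \<in> topspace E" "p e = h c" using surj by (metis imageE)
    \<comment> \<open>Scaling starts at the corner \<open>c\<close> at time 0 and reaches
      \<open>y\<close> at time 1, so the constant 1 is taken for \<open>\<phi>\<close>.\<close>
    define H :: "real \<times> (nat \<Rightarrow> real) \<Rightarrow> nat \<Rightarrow> real"
      where "H = (\<lambda>(t, y). \<lambda>a\<in>{..<N}. t * y a)"
    let ?P = "prod_topology (top_of_set {0..1::real}) (cube N)"
    have cH: "continuous_map ?P (cube N) H"
    proof (rule continuous_map_into_cube)
      show "H \<in> topspace ?P \<rightarrow> topspace (cube N)"
        by (auto simp: H_def in_topspace_cube mult_le_one)
      fix i assume i: "i < N"
      have c1: "continuous_map ?P euclideanreal (\<lambda>z. snd z i)"
        using continuous_map_compose[OF continuous_map_snd continuous_map_cube_coord[OF i]]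
        by (simp add: o_def)
      have c3: "continuous_map ?P euclideanreal fst"
        using continuous_map_into_fulltopology[OF continuous_map_fst] .
      have "(\<lambda>z. H z i) = (\<lambda>z. fst z * snd z i)"
        using i by (auto simp: H_def fun_eq_iff)
      then show "continuous_map ?P euclideanreal (\<lambda>z. H z i)"
        using c1 c3 by (simp add: continuous_map_real_mult)
    qed
    have H0: "H (0, y) = c" for y by (auto simp: H_def c_def)
    have H1: "H (1, y) = y" if "y \<in> topspace (cube N)" for y
      using that by (auto simp: H_def in_topspace_cube fun_eq_iff extensional_def restrict_def)
    obtain g where "continuous_map (cube N) E g"
      "\<And>y. y \<in> topspace (cube N) \<Longrightarrow> p (g y) = h y"
    proof (rule serre_fibration_lift[OF p h _ cH])
      show "continuous_map (cube N) E (\<lambda>_. e)" using e(1) by simp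
      show "continuous_map (cube N) (top_of_set {0..1::real}) (\<lambda>_. 1)" by simp
      show "p e = h (H (0, y))" for y using e(2) H0 by simp
    qed (use H1 in auto)
    then show ?thesis using that 2 by blast
  next
    case 3
    obtain \<phi> H where phi: "continuous_map (cube N) (top_of_set {0..1}) \<phi>"
      and H: "continuous_map (prod_topology (top_of_set {0..1::real}) (cube N)) (cube N) H"
      and H0: "\<And>y. y \<in> topspace (cube N) \<Longrightarrow> H (0, y) \<in> A"
      and H1: "\<And>y. y \<in> topspace (cube N) \<Longrightarrow> H (\<phi> y, y) = y"
      and phi0: "\<And>y. y \<in> A \<Longrightarrow> \<phi> y = 0"
      using cube_faces_deformation[OF 3(1,2)] unfolding 3(3) by blast
    have "continuous_map (cube N) (prod_topology (top_of_set {0..1::real}) (cube N)) (\<lambda>y. (0::real, y))"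
      by (intro continuous_map_pairedI) auto
    from continuous_map_compose[OF this H]
    have "continuous_map (cube N) (subtopology (cube N) A) (\<lambda>y. H (0, y))"
      using H0 by (auto simp: continuous_map_in_subtopology o_def)
    from continuous_map_compose[OF this f]
    have f': "continuous_map (cube N) E (\<lambda>y. f (H (0, y)))" by (simp add: o_def)
    obtain g where g: "continuous_map (cube N) E g"
      "\<And>y. y \<in> topspace (cube N) \<Longrightarrow> p (g y) = h y"
      "\<And>y. y \<in> topspace (cube N) \<Longrightarrow> \<phi> y = 0 \<Longrightarrow> g y = f (H (0, y))"
      using serre_fibration_lift[OF p h f' H phi pf[OF H0] H1] by blast
    have "g y = f y" if "y \<in> A" for y
    proof -
      have y: "y \<in> topspace (cube N)" using cube_piece_subset[OF A] that by blast
      show ?thesis using g(3)[OF y phi0[OF that]] H1[OF y] phi0[OF that] by simp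
    qed
    then show ?thesis using that g by blast
  qed
qed

text \<open>The start of the flow, \<open>y \<mapsto> H (0, y)\<close>, is a retraction of the cube
  onto \<open>A\<close>: on \<open>A\<close> the time \<open>\<phi> y\<close> is 0. Composing
  \<open>f\<close> with it gives the extension.\<close>

lemma cube_piece_extend:
  assumes A: "cube_piece N A" "A \<noteq> {}"
    and f: "continuous_map (subtopology (cube N) A) E f"
  obtains g where "continuous_map (cube N) E g" and "\<And>x. x \<in> A \<Longrightarrow> g x = f x"
proof -
  consider "A = topspace (cube N)"
    | S where "S \<subseteq> {..<N}" "S \<noteq> {}" "A = cube_faces N S"
    using A by (auto simp: cube_piece_def cube_faces_def)
  then show thesis
  proof cases
    case 1
    then show ?thesis using that[of f] f by simp
  next
    case 2
    obtain \<phi> H where "continuous_map (cube N) (top_of_set {0..1}) \<phi>"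
      and H: "continuous_map (prod_topology (top_of_set {0..1::real}) (cube N)) (cube N) H"
      and H0: "\<And>y. y \<in> topspace (cube N) \<Longrightarrow> H (0, y) \<in> A"
      and H1: "\<And>y. y \<in> topspace (cube N) \<Longrightarrow> H (\<phi> y, y) = y"
      and phi0: "\<And>y. y \<in> A \<Longrightarrow> \<phi> y = 0"
      using cube_faces_deformation[OF 2(1,2)] unfolding 2(3) by blast
    have "continuous_map (cube N) (prod_topology (top_of_set {0..1::real}) (cube N)) (\<lambda>y. (0::real, y))"
      by (intro continuous_map_pairedI) auto
    from continuous_map_compose[OF this H]
    have "continuous_map (cube N) (subtopology (cube N) A) (\<lambda>y. H (0, y))"
      using H0 by (auto simp: continuous_map_in_subtopology o_def)
    from continuous_map_compose[OF this f]
    have "continuous_map (cube N) E (\<lambda>y. f (H (0, y)))" by (simp add: o_def)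
    moreover have "f (H (0, y)) = f y" if "y \<in> A" for y
    proof -
      have y: "y \<in> topspace (cube N)" using cube_piece_subset[OF A(1)] that by blast
      show ?thesis using H1[OF y] phi0[OF that] by simp
    qed
    ultimately show ?thesis using that by blast
  qed
qed

section \<open>Extending partial horn data over a cube\<close>

text \<open>
  For \<open>m = 0\<close> there are no maps \<open>s i\<close>, and a nonempty \<open>B\<close> is what guarantees a point in level \<open>0\<close>.
\<close>

definition horn_data where
  "horn_data Z N m k D s B b \<longleftrightarrow>
     k \<le> m \<and>
     (\<forall>i\<le>m. i \<noteq> k \<longrightarrow> cube_piece N (D i) \<and> D i \<noteq> {} \<and>
        continuous_map (subtopology (cube N) (D i)) (level Z (m - 1)) (s i)) \<and>
     (\<forall>i j. i < j \<longrightarrow> j \<le> m \<longrightarrow> i \<noteq> k \<longrightarrow> j \<noteq> k \<longrightarrow>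
        (\<forall>x\<in>D i \<inter> D j. face Z (m - 1) i (s j x) = face Z (m - 1) (j - 1) (s i x))) \<and>
     cube_piece N B \<and> (m = 0 \<longrightarrow> B \<noteq> {}) \<and>
     continuous_map (subtopology (cube N) B) (level Z m) b \<and>
     (\<forall>i\<le>m. i \<noteq> k \<longrightarrow> (\<forall>x\<in>B \<inter> D i. face Z m i (b x) = s i x))"

definition horn_filler where
  "horn_filler Z N m k D s B b \<sigma> \<longleftrightarrow>
     continuous_map (cube N) (level Z m) \<sigma> \<and> (\<forall>x\<in>B. \<sigma> x = b x) \<and>
     (\<forall>i\<le>m. i \<noteq> k \<longrightarrow> (\<forall>x\<in>D i. face Z m i (\<sigma> x) = s i x))"

lemma horn_dataD:
  assumes "horn_data Z N m k D s B b"
  shows "k \<le> m"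
    and "\<And>i. i \<le> m \<Longrightarrow> i \<noteq> k \<Longrightarrow> cube_piece N (D i)"
    and "\<And>i. i \<le> m \<Longrightarrow> i \<noteq> k \<Longrightarrow> D i \<noteq> {}"
    and "\<And>i. i \<le> m \<Longrightarrow> i \<noteq> k \<Longrightarrow>
      continuous_map (subtopology (cube N) (D i)) (level Z (m - 1)) (s i)"
    and "\<And>i j x. i < j \<Longrightarrow> j \<le> m \<Longrightarrow> i \<noteq> k \<Longrightarrow> j \<noteq> k \<Longrightarrow> x \<in> D i \<Longrightarrow> x \<in> D j \<Longrightarrow>
      face Z (m - 1) i (s j x) = face Z (m - 1) (j - 1) (s i x)"
    and "cube_piece N B" and "m = 0 \<Longrightarrow> B \<noteq> {}"
    and "continuous_map (subtopology (cube N) B) (level Z m) b"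
    and "\<And>i x. i \<le> m \<Longrightarrow> i \<noteq> k \<Longrightarrow> x \<in> B \<Longrightarrow> x \<in> D i \<Longrightarrow> face Z m i (b x) = s i x"
  using assms unfolding horn_data_def by blast+

lemma horn_data_value_in:
  assumes "horn_data Z N m k D s B b" "i \<le> m" "i \<noteq> k" "x \<in> D i"
  shows "s i x \<in> topspace (level Z (m - 1))"
proof -
  note h = horn_dataD[OF assms(1)]
  have "x \<in> topspace (subtopology (cube N) (D i))"
    using cube_piece_subset[OF h(2)[OF assms(2,3)]] assms(4) by auto
  with h(4)[OF assms(2,3)] show ?thesis unfolding continuous_map_def by blast
qed

lemma horn_data_base_in:
  assumes "horn_data Z N m k D s B b" "x \<in> B"
  shows "b x \<in> topspace (level Z m)"
proof -
  note h = horn_dataD[OF assms(1)]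
  have "x \<in> topspace (subtopology (cube N) B)"
    using cube_piece_subset[OF h(6)] assms(2) by auto
  with h(8) show ?thesis unfolding continuous_map_def by blast
qed

text \<open>The maps \<open>s i\<close>, now defined everywhere, assemble to a map \<open>w\<close>
  into the horn space, and \<open>b\<close> is a lift of \<open>w\<close> over \<open>B\<close>. The
  topological Kan condition allows this lift to be extended to the cube.\<close>

lemma horn_filler_total:
  assumes K: "topological_kan Z" and hd: "horn_data Z N m k D s B b" and m: "1 \<le> m"
    and D: "\<And>i. i \<le> m \<Longrightarrow> i \<noteq> k \<Longrightarrow> D i = topspace (cube N)"
  shows "\<exists>\<sigma>. horn_filler Z N m k D s B b \<sigma>"
proof -
  note h = horn_dataD[OF hd]
  define w where "w x = (\<lambda>i\<in>{0..m} - {k}. s i x)" for x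
  have cs: "continuous_map (cube N) (level Z (m - 1)) (s i)" if "i \<le> m" "i \<noteq> k" for i
    using h(4)[OF that] D[OF that] by simp
  have "continuous_map (cube N) (level Z (m - 1)) (\<lambda>x. w x i)" if "i \<in> {0..m} - {k}" for i
    using cs[of i] that by (simp add: w_def)
  then have cw: "continuous_map (cube N) (horn_space Z m k) w"
    using h(5) D
    by (auto simp: horn_space_def continuous_map_in_subtopology continuous_map_componentwise
        horn_compatible_def w_def)
  have sf: "serre_fibration (level Z m) (horn_space Z m k) (horn_map (face Z) m k)"
    and sj: "horn_map (face Z) m k ` topspace (level Z m) = topspace (horn_space Z m k)"
    using K m h(1) by (auto simp: topological_kan_def)
  have pb: "horn_map (face Z) m k (b x) = w x" if "x \<in> B" for x
  proof -
    have "x \<in> topspace (cube N)" using cube_piece_subset[OF h(6)] that by blast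
    then have "face Z m i (b x) = s i x" if "i \<in> {0..m} - {k}" for i
      using h(9)[of i x] D[of i] that \<open>x \<in> B\<close> by simp
    then show ?thesis unfolding horn_map_def w_def by (intro restrict_ext) simp
  qed
  obtain \<sigma> where g: "continuous_map (cube N) (level Z m) \<sigma>"
    "\<And>x. x \<in> topspace (cube N) \<Longrightarrow> horn_map (face Z) m k (\<sigma> x) = w x"
    "\<And>x. x \<in> B \<Longrightarrow> \<sigma> x = b x"
    using serre_fibration_pair_lift[OF sf sj h(6) h(8) cw pb] by blast
  have "face Z m i (\<sigma> x) = s i x" if "i \<le> m" "i \<noteq> k" "x \<in> D i" for i x
    using fun_cong[OF g(2)[of x], of i] that D[of i] by (simp add: horn_map_def w_def)
  then have "horn_filler Z N m k D s B b \<sigma>"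
    using g(1,3) unfolding horn_filler_def by blast
  then show ?thesis by blast
qed

text \<open>Here \<open>k = 0\<close>, so no face is prescribed and only \<open>b\<close> has to be
  extended.\<close>

lemma horn_filler_0:
  assumes "horn_data Z N 0 k D s B b"
  shows "\<exists>\<sigma>. horn_filler Z N 0 k D s B b \<sigma>"
proof -
  note h = horn_dataD[OF assms]
  obtain \<sigma> where "continuous_map (cube N) (level Z 0) \<sigma>" "\<And>x. x \<in> B \<Longrightarrow> \<sigma> x = b x"
    using cube_piece_extend[OF h(6) h(7)[OF refl] h(8)] by blast
  then have "horn_filler Z N 0 k D s B b \<sigma>"
    using h(1) by (auto simp: horn_filler_def)
  then show ?thesis by blast
qed

text \<open>
  Deleting \<open>j\<close> from \<open>{0..Suc q}\<close> and renumbering turns the faces \<open>i \<notin> {j, k}\<close> of the problem into the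
  faces of a horn problem of dimension \<open>q\<close> for the missing \<open>j\<close>-th face.
\<close>

definition link_index :: "nat \<Rightarrow> nat \<Rightarrow> nat" where
  "link_index j k = (if k < j then k else k - 1)"

definition link_pieces :: "nat \<Rightarrow> (nat \<Rightarrow> 'b) \<Rightarrow> nat \<Rightarrow> 'b" where
  "link_pieces j D i = (if i < j then D i else D (Suc i))"

definition link_maps where
  "link_maps Z m j s i x =
     (if i < j then face Z (m - 1) (j - 1) (s i x) else face Z (m - 1) j (s (Suc i) x))"

text \<open>A total \<open>j\<close>-th face \<open>t\<close> must satisfy
  \<open>d\<^sub>i t = d\<^sub>j\<^sub>-\<^sub>1 s\<^sub>i\<close> for \<open>i < j\<close> and
  \<open>d\<^sub>i t = d\<^sub>j s\<^sub>i\<^sub>+\<^sub>1\<close> for \<open>i \<ge> j\<close>, by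
  the simplicial identities, and equal \<open>s j\<close> on \<open>D j\<close> and
  \<open>d\<^sub>j b\<close> on \<open>B\<close>. These demands are consistent because the original
  data are compatible.\<close>

lemma horn_data_link:
  assumes Z: "simplicial_space Z" and hd: "horn_data Z N (Suc q) k D s B b"
    and j: "j \<le> Suc q" "j \<noteq> k"
  shows "horn_data Z N q (link_index j k) (link_pieces j D) (link_maps Z (Suc q) j s)
    (D j \<union> B) (\<lambda>x. if x \<in> D j then s j x else face Z (Suc q) j (b x))"
    (is "horn_data Z N q ?k ?D ?s ?B ?b")
proof -
  note h = horn_dataD[OF hd, simplified]
  note Zin = horn_data_value_in[OF hd, simplified]
  note Bin = horn_data_base_in[OF hd]
  have cf: "continuous_map (level Z (Suc n)) (level Z n) (face Z (Suc n) i)"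
    if "i \<le> Suc n" for n i
    using Z that unfolding simplicial_space_def by (metis One_nat_def diff_Suc_1 le_add1 plus_1_eq_Suc)
  \<comment> \<open>For \<open>q = 0\<close> the only index is \<open>?k\<close> itself. Hence the
    faces out of level \<open>q\<close> used in \<open>link_maps\<close> are within range.\<close>
  have pos: "1 \<le> q" if "i \<le> q" "i \<noteq> ?k" for i
    using that j h(1) by (auto simp: link_index_def split: if_splits)
  have low: "i \<le> Suc q \<and> i \<noteq> k" if "i \<le> q" "i \<noteq> ?k" "i < j" for i
    using that j h(1) by (auto simp: link_index_def split: if_splits)
  have high: "Suc i \<le> Suc q \<and> Suc i \<noteq> k" if "i \<le> q" "i \<noteq> ?k" "\<not> i < j" for i
    using that j h(1) by (auto simp: link_index_def split: if_splits)
  show ?thesis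
    unfolding horn_data_def
  proof (intro conjI allI impI ballI)
    show "?k \<le> q" using j h(1) by (auto simp: link_index_def)
  next
    fix i assume i: "i \<le> q" "i \<noteq> ?k"
    show "cube_piece N (?D i)" "?D i \<noteq> {}"
      using low[OF i] high[OF i] h(2,3) by (auto simp: link_pieces_def)
    obtain r where q: "q = Suc r" using pos[OF i] by (cases q) auto
    show "continuous_map (subtopology (cube N) (?D i)) (level Z (q - 1)) (?s i)"
    proof (cases "i < j")
      case True
      have "continuous_map (subtopology (cube N) (D i)) (level Z (Suc r)) (s i)"
        using h(4)[of i] low[OF i True] q by simp
      from continuous_map_compose[OF this cf[of "j - 1" r]] show ?thesis
        using True j q by (simp add: link_pieces_def link_maps_def[abs_def] o_def)
    next
      case False
      have "continuous_map (subtopology (cube N) (D (Suc i))) (level Z (Suc r)) (s (Suc i))"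
        using h(4)[of "Suc i"] high[OF i False] q by simp
      from continuous_map_compose[OF this cf[of j r]] show ?thesis
        using False i q by (simp add: link_pieces_def link_maps_def[abs_def] o_def)
    qed
  next
    fix i i' x assume ii: "i < i'" "i' \<le> q" "i \<noteq> ?k" "i' \<noteq> ?k" and x: "x \<in> ?D i \<inter> ?D i'"
    \<comment> \<open>The indices \<open>i\<close>, \<open>i'\<close> and \<open>?k\<close> are
      distinct and at most \<open>q\<close>.\<close>
    have q2: "2 \<le> q" using ii j h(1) by (auto simp: link_index_def split: if_splits)
    note ffs = sspace_face_face[OF Z q2]
    have i: "i \<le> q" using ii by simp
    \<comment> \<open>Since \<open>i < i'\<close>, three positions relative to \<open>j\<close>
      remain. Each is a chain of a simplicial identity, the compatibility of the \<open>s i\<close>,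
      and a simplicial identity again.\<close>
    consider "i' < j" | "i < j" "\<not> i' < j" | "\<not> i < j" by linarith
    then show "face Z (q - 1) i (?s i' x) = face Z (q - 1) (i' - 1) (?s i x)"
    proof cases
      case 1
      then have 2: "i < j" using ii by simp
      have xs: "x \<in> D i" "x \<in> D i'" using x 1 2 by (auto simp: link_pieces_def)
      have "face Z (q - 1) i (face Z q (j - 1) (s i' x))
          = face Z (q - 1) (j - 1 - 1) (face Z q i (s i' x))"
        using ii 1 j xs low[OF ii(2,4) 1] by (intro ffs Zin) auto
      also have "face Z q i (s i' x) = face Z q (i' - 1) (s i x)"
        using h(5)[of i i' x] low[OF ii(2,4) 1] low[OF i ii(3) 2] ii xs by simp
      also have "face Z (q - 1) (j - 1 - 1) (face Z q (i' - 1) (s i x))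
          = face Z (q - 1) (i' - 1) (face Z q (j - 1) (s i x))"
        using ii 1 j xs low[OF i ii(3) 2] by (intro ffs[symmetric] Zin) auto
      finally show ?thesis using 1 2 by (simp add: link_maps_def)
    next
      case 2
      have xs: "x \<in> D i" "x \<in> D (Suc i')" using x 2 by (auto simp: link_pieces_def)
      have "face Z (q - 1) i (face Z q j (s (Suc i') x))
          = face Z (q - 1) (j - 1) (face Z q i (s (Suc i') x))"
        using ii 2 j xs high[OF ii(2,4) 2(2)] by (intro ffs Zin) auto
      also have "face Z q i (s (Suc i') x) = face Z q i' (s i x)"
        using h(5)[of i "Suc i'" x] high[OF ii(2,4) 2(2)] low[OF i ii(3) 2(1)] ii xs by simp
      also have "face Z (q - 1) (j - 1) (face Z q i' (s i x))
          = face Z (q - 1) (i' - 1) (face Z q (j - 1) (s i x))"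
        using ii 2 j xs low[OF i ii(3) 2(1)] by (intro ffs Zin) auto
      finally show ?thesis using 2 by (simp add: link_maps_def)
    next
      case 3
      then have 4: "\<not> i' < j" using ii by simp
      have xs: "x \<in> D (Suc i)" "x \<in> D (Suc i')" using x 3 4 by (auto simp: link_pieces_def)
      have "face Z (q - 1) i (face Z q j (s (Suc i') x))
          = face Z (q - 1) j (face Z q (Suc i) (s (Suc i') x))"
        using ffs[of j "Suc i" "s (Suc i') x"] ii 3 xs high[OF ii(2,4) 4] Zin[of "Suc i'" x] by simp
      also have "face Z q (Suc i) (s (Suc i') x) = face Z q i' (s (Suc i) x)"
        using h(5)[of "Suc i" "Suc i'" x] high[OF ii(2,4) 4] high[OF i ii(3) 3] ii xs by simp
      also have "face Z (q - 1) j (face Z q i' (s (Suc i) x))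
          = face Z (q - 1) (i' - 1) (face Z q j (s (Suc i) x))"
        using ii 3 j xs high[OF i ii(3) 3] by (intro ffs Zin) auto
      finally show ?thesis using 3 4 by (simp add: link_maps_def)
    qed
  next
    show "cube_piece N ?B" using h(2,6) j by (simp add: cube_piece_Un)
    \<comment> \<open>The nonempty \<open>D j\<close> supplies the nonempty base demanded in
      dimension 0.\<close>
    show "?B \<noteq> {}" using h(3) j by simp
    let ?X = "subtopology (cube N) ?B"
    have sub: "D j \<subseteq> topspace (cube N)" "B \<subseteq> topspace (cube N)"
      using cube_piece_subset h(2,6) j by blast+
    have clo: "closedin ?X (D j)" "closedin ?X B"
      using closedin_cube_piece[OF h(2)[OF j]] closedin_cube_piece[OF h(6)]
      by (auto intro: closedin_subset_topspace)
    show "continuous_map ?X (level Z q) ?b"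
    \<comment> \<open>Two closed pieces, indexed by booleans: \<open>True\<close> for
      \<open>D j\<close>, \<open>False\<close> for \<open>B\<close>. On the overlap the formulas
      agree because \<open>d\<^sub>j b = s\<^sub>j\<close> there.\<close>
    proof (rule pasting_lemma_closed[where I = "UNIV :: bool set"
          and T = "\<lambda>c. if c then D j else B"
          and f = "\<lambda>c x. if c then s j x else face Z (Suc q) j (b x)"])
      show "closedin ?X (if c then D j else B)" for c using clo by simp
      show "continuous_map (subtopology ?X (if c then D j else B)) (level Z q)
          (\<lambda>x. if c then s j x else face Z (Suc q) j (b x))" for c
        using h(4)[OF j] continuous_map_compose[OF h(8) cf[of j q]] j
        by (cases c) (simp_all add: subtopology_subtopology o_def Int_absorb1)
      show "(if c then s j x else face Z (Suc q) j (b x)) =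
            (if c' then s j x else face Z (Suc q) j (b x))"
        if "x \<in> topspace ?X \<inter> (if c then D j else B) \<inter> (if c' then D j else B)" for c c' x
        using that h(9)[OF j, of x] by (auto split: if_splits)
      show "\<exists>c. c \<in> UNIV \<and> x \<in> (if c then D j else B) \<and>
          ?b x = (if c then s j x else face Z (Suc q) j (b x))"
        if "x \<in> topspace ?X" for x
      proof (cases "x \<in> D j")
        case True
        then show ?thesis by (intro exI[of _ True]) simp
      next
        case False
        then show ?thesis using that by (intro exI[of _ False]) simp
      qed
    qed simp
  next
    fix i x assume i: "i \<le> q" "i \<noteq> ?k" and x: "x \<in> ?B \<inter> ?D i"
    have q2: "2 \<le> Suc q" using pos[OF i] by simp
    note ffs = sspace_face_face[OF Z q2, simplified]
    show "face Z q i (?b x) = ?s i x"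
    proof (cases "i < j")
      case True
      then have xi: "x \<in> D i" using x by (simp add: link_pieces_def)
      show ?thesis
      proof (cases "x \<in> D j")
        case xj: True
        then show ?thesis
          using True h(5)[OF True j(1) _ j(2) xi xj] low[OF i True] by (simp add: link_maps_def)
      next
        case False
        then have xb: "x \<in> B" using x by simp
        then show ?thesis
          using False True ffs[OF True j(1) Bin[OF xb]] h(9)[OF _ _ xb xi] low[OF i True]
          by (simp add: link_maps_def)
      qed
    next
      case nl: False
      then have xi: "x \<in> D (Suc i)" using x by (simp add: link_pieces_def)
      have ji: "j < Suc i" using nl by simp
      show ?thesis
      proof (cases "x \<in> D j")
        case xj: True
        then show ?thesis
          using nl h(5)[OF ji _ j(2) _ xj xi] high[OF i nl] by (simp add: link_maps_def)
      next
        case False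
        then have xb: "x \<in> B" using x by simp
        then show ?thesis
          using False nl ffs[OF ji _ Bin[OF xb]] h(9)[OF _ _ xb xi] high[OF i nl]
          by (simp add: link_maps_def)
      qed
    qed
  qed
qed

text \<open>The face conditions solved by \<open>\<tau>\<close> are exactly its compatibility with
  the other \<open>s i\<close>, and its values on \<open>D j \<union> B\<close> give agreement with
  \<open>s j\<close> and with \<open>d\<^sub>j b\<close>.\<close>

lemma horn_data_replace:
  assumes hd: "horn_data Z N (Suc q) k D s B b"
    and j: "j \<le> Suc q" "j \<noteq> k"
    and \<tau>: "horn_filler Z N q (link_index j k) (link_pieces j D) (link_maps Z (Suc q) j s)
      (D j \<union> B) (\<lambda>x. if x \<in> D j then s j x else face Z (Suc q) j (b x)) \<tau>"
  shows "horn_data Z N (Suc q) k (D(j := topspace (cube N))) (s(j := \<tau>)) B b"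
    and "\<And>x. x \<in> D j \<Longrightarrow> \<tau> x = s j x"
proof -
  note h = horn_dataD[OF hd, simplified]
  have ct: "continuous_map (cube N) (level Z q) \<tau>"
    and tj: "\<And>x. x \<in> D j \<Longrightarrow> \<tau> x = s j x"
    and tb: "\<And>x. x \<in> B \<Longrightarrow> x \<notin> D j \<Longrightarrow> \<tau> x = face Z (Suc q) j (b x)"
    and tf: "\<And>i x. i \<le> q \<Longrightarrow> i \<noteq> link_index j k \<Longrightarrow> x \<in> link_pieces j D i \<Longrightarrow>
      face Z q i (\<tau> x) = link_maps Z (Suc q) j s i x"
    using \<tau> unfolding horn_filler_def by auto
  show "\<tau> x = s j x" if "x \<in> D j" for x using tj that .
  have ne: "topspace (cube N) \<noteq> {}" using cube_piece_subset[OF h(2)[OF j]] h(3)[OF j] by blast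
  \<comment> \<open>\<open>low\<close> and \<open>high\<close> undo the renumbering of the link, on
    either side of \<open>j\<close>.\<close>
  have low: "face Z q i (\<tau> x) = face Z q (j - 1) (s i x)" if "i < j" "i \<noteq> k" "x \<in> D i" for i x
  proof -
    have "i \<le> q" "i \<noteq> link_index j k"
      using that j h(1) by (auto simp: link_index_def split: if_splits)
    then show ?thesis using tf[of i x] that by (simp add: link_pieces_def link_maps_def)
  qed
  have high: "face Z q j (s i x) = face Z q (i - 1) (\<tau> x)"
    if "j < i" "i \<le> Suc q" "i \<noteq> k" "x \<in> D i" for i x
  proof -
    obtain i' where i': "i = Suc i'" using \<open>j < i\<close> by (cases i) auto
    have "i' \<le> q" "i' \<noteq> link_index j k"
      using that i' j h(1) by (auto simp: link_index_def split: if_splits)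
    then show ?thesis using tf[of i' x] that i' by (simp add: link_pieces_def link_maps_def)
  qed
  show "horn_data Z N (Suc q) k (D(j := topspace (cube N))) (s(j := \<tau>)) B b"
    unfolding horn_data_def
  proof (intro conjI allI impI ballI)
    fix i assume "i \<le> Suc q" "i \<noteq> k"
    then show "cube_piece N ((D(j := topspace (cube N))) i)"
      "(D(j := topspace (cube N))) i \<noteq> {}"
      "continuous_map (subtopology (cube N) ((D(j := topspace (cube N))) i))
        (level Z (Suc q - 1)) ((s(j := \<tau>)) i)"
      using h(2-4) ne ct by (auto simp: cube_piece_def)
  next
    fix i i' x
    assume "i < i'" "i' \<le> Suc q" "i \<noteq> k" "i' \<noteq> k"
      "x \<in> (D(j := topspace (cube N))) i \<inter> (D(j := topspace (cube N))) i'"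
    then show "face Z (Suc q - 1) i ((s(j := \<tau>)) i' x) = face Z (Suc q - 1) (i' - 1) ((s(j := \<tau>)) i x)"
      using h(5)[of i i' x] low[of i x] high[of i' x] by (cases "i = j"; cases "i' = j") simp_all
  next
    fix i x assume "i \<le> Suc q" "i \<noteq> k" and x: "x \<in> B \<inter> (D(j := topspace (cube N))) i"
    then show "face Z (Suc q) i (b x) = (s(j := \<tau>)) i x"
      using h(9)[of i x] tj[of x] tb[of x] by (cases "i = j"; cases "x \<in> D j") auto
  qed (use h in simp_all)
qed

text \<open>Outer induction on \<open>m\<close>, with the cube fixed and all other data arbitrary;
  inner induction on the number of \<open>i \<noteq> k\<close> whose \<open>D i\<close> is not the
  whole cube. Solving the link problem in dimension \<open>q\<close> makes one more
  \<open>D j\<close> total.\<close>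

lemma horn_filler_exists:
  assumes Z: "simplicial_space Z" and K: "topological_kan Z"
    and "horn_data Z N m k D s B b"
  shows "\<exists>\<sigma>. horn_filler Z N m k D s B b \<sigma>"
  using assms(3)
proof (induction m arbitrary: k D s B b)
  case 0
  then show ?case by (rule horn_filler_0)
next
  case (Suc q)
  show ?case
    using Suc.prems
  proof (induction "card {i. i \<le> Suc q \<and> i \<noteq> k \<and> D i \<noteq> topspace (cube N)}" arbitrary: D s rule: less_induct)
    case less
    show ?case
    proof (cases "\<exists>j\<le>Suc q. j \<noteq> k \<and> D j \<noteq> topspace (cube N)")
      case False
      then show ?thesis by (intro horn_filler_total[OF K less.prems]) auto
    next
      case True
      then obtain j where j: "j \<le> Suc q" "j \<noteq> k" and Dj: "D j \<noteq> topspace (cube N)" by blast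
      obtain \<tau> where \<tau>: "horn_filler Z N q (link_index j k) (link_pieces j D)
          (link_maps Z (Suc q) j s) (D j \<union> B)
          (\<lambda>x. if x \<in> D j then s j x else face Z (Suc q) j (b x)) \<tau>"
        using Suc.IH[OF horn_data_link[OF Z less.prems j]] by blast
      let ?D = "D(j := topspace (cube N))" and ?s = "s(j := \<tau>)"
      have "{i. i \<le> Suc q \<and> i \<noteq> k \<and> ?D i \<noteq> topspace (cube N)}
          \<subset> {i. i \<le> Suc q \<and> i \<noteq> k \<and> D i \<noteq> topspace (cube N)}"
        using j Dj by auto
      then have "card {i. i \<le> Suc q \<and> i \<noteq> k \<and> ?D i \<noteq> topspace (cube N)}
          < card {i. i \<le> Suc q \<and> i \<noteq> k \<and> D i \<noteq> topspace (cube N)}"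
        by (intro psubset_card_mono) auto
      from less.hyps[OF this horn_data_replace(1)[OF less.prems j \<tau>]]
      obtain \<sigma> where \<sigma>: "horn_filler Z N (Suc q) k ?D ?s B b \<sigma>" by blast
      \<comment> \<open>As \<open>\<tau>\<close> extends \<open>s j\<close>, a filler for the
        enlarged data also fills the original data.\<close>
      have "D j \<subseteq> topspace (cube N)"
        using cube_piece_subset[OF horn_dataD(2)[OF less.prems j]] .
      then have "horn_filler Z N (Suc q) k D s B b \<sigma>"
        using \<sigma> horn_data_replace(2)[OF less.prems j \<tau>]
        unfolding horn_filler_def by (metis fun_upd_apply subsetD)
      then show ?thesis by blast
    qed
  qed
qed

section \<open>From the cube to the simplex\<close>

text \<open>On the face \<open>x k = 0\<close>, collapsing amounts to deleting the zero coordinate.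
  This includes the last face \<open>k = Suc p\<close>, where the collapse leaves \<open>x\<close>
  unchanged.\<close>

lemma simplicial_degen_zero_in_standard_simplex:
  assumes x: "x \<in> standard_simplex (Suc p)" and "k \<le> Suc p" "x k = 0"
  shows "simplicial_degen k x \<in> standard_simplex p"
proof (cases "k \<le> p")
  case True
  then show ?thesis using x by (rule simplicial_degen_in_standard_simplex)
next
  case False
  then have k: "k = Suc p" using assms(2) by simp
  have z: "x i = 0" if "i > p" for i
    using that k assms(3) x by (cases "i = Suc p") (auto simp: standard_simplex_def)
  then have "simplicial_degen k x = x"
    using k by (auto simp: simplicial_degen_def fun_eq_iff)
  then show ?thesis using x z by (simp add: standard_simplex_def)
qed

text \<open>Together with \<open>simplicial_degen_face_same\<close>, this makes the collapse inverse
  to the coface on the face it parametrises.\<close>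

lemma simplical_face_degen_zero:
  "x k = 0 \<Longrightarrow> simplical_face k (simplicial_degen k x) = x"
  by (auto simp: simplical_face_def simplicial_degen_def fun_eq_iff)

text \<open>The retraction of the cube onto the simplex: coordinates other than \<open>k\<close> are
  scaled down until their sum is at most 1, and coordinate \<open>k\<close> takes the remainder. The
  divisor \<open>M\<close> is at least 1, so the map is continuous.\<close>

definition cube_to_simplex :: "nat \<Rightarrow> nat \<Rightarrow> (nat \<Rightarrow> real) \<Rightarrow> nat \<Rightarrow> real" where
  "cube_to_simplex n k x i =
     (let M = max 1 (\<Sum>l\<in>{..n} - {k}. x l)
      in if i = k then 1 - (\<Sum>l\<in>{..n} - {k}. x l / M) else if i \<le> n then x i / M else 0)"

lemma cube_to_simplex_in:
  assumes k: "k \<le> n" and x: "x \<in> topspace (cube (Suc n))"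
  shows "cube_to_simplex n k x \<in> standard_simplex n"
proof -
  let ?S = "\<Sum>l\<in>{..n} - {k}. x l"
  let ?M = "max 1 ?S"
  let ?y = "cube_to_simplex n k x"
  have nn: "0 \<le> x l" if "l \<le> n" for l
    using x that by (simp add: in_topspace_cube)
  have s: "(\<Sum>l\<in>{..n} - {k}. x l / ?M) = ?S / ?M"
    by (simp add: sum_divide_distrib)
  have "(\<Sum>i\<in>{..n} - {k}. ?y i) = ?S / ?M"
    unfolding s[symmetric] by (intro sum.cong) (auto simp: cube_to_simplex_def Let_def)
  moreover have "?y k = 1 - ?S / ?M"
    by (simp add: cube_to_simplex_def Let_def s)
  ultimately have sum1: "(\<Sum>i\<le>n. ?y i) = 1"
    using k by (subst sum.remove[of _ k]) auto
  have "?S / ?M \<le> 1" by (simp add: divide_le_eq max_def)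
  then have y0: "0 \<le> ?y i" for i
    using nn by (auto simp: cube_to_simplex_def Let_def s)
  have z: "?y i = 0" if "i > n" for i
    using that k by (simp add: cube_to_simplex_def Let_def)
  have "?y i \<le> 1" for i
  proof (cases "i \<le> n")
    case True
    then show ?thesis using member_le_sum[of i "{..n}" ?y] y0 sum1 by auto
  next
    case False
    then show ?thesis using z by simp
  qed
  then show ?thesis using sum1 y0 z by (auto simp: standard_simplex_def)
qed

lemma cube_to_simplex_zero:
  "i \<noteq> k \<Longrightarrow> x i = 0 \<Longrightarrow> cube_to_simplex n k x i = 0"
  by (simp add: cube_to_simplex_def Let_def)

text \<open>On the simplex the coordinates other than \<open>k\<close> sum to
  \<open>1 - x k \<le> 1\<close>, so \<open>M = 1\<close>. The \<open>restrict\<close> is needed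
  since simplex points are 0 beyond \<open>n\<close>, whereas cube points are
  \<open>undefined\<close> there.\<close>

lemma cube_to_simplex_retract:
  assumes k: "k \<le> n" and x: "x \<in> standard_simplex n"
  shows "cube_to_simplex n k (restrict x {..<Suc n}) = x"
proof -
  have 1: "(\<Sum>l\<in>{..n} - {k}. restrict x {..<Suc n} l) = (\<Sum>l\<in>{..n} - {k}. x l)"
    by (intro sum.cong) auto
  have 2: "x k + (\<Sum>l\<in>{..n} - {k}. x l) = 1"
    using x k sum.remove[of "{..n}" k x] by (simp add: standard_simplex_def)
  have "0 \<le> x k" using x by (simp add: standard_simplex_def)
  then have M: "max 1 (\<Sum>l\<in>{..n} - {k}. x l) = 1"
    using 2 by simp
  show ?thesis
    using x k 2 unfolding fun_eq_iff cube_to_simplex_def Let_def 1 M div_by_1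
    by (auto simp: standard_simplex_def)
qed

lemma continuous_map_cube_to_simplex:
  assumes k: "k \<le> n"
  shows "continuous_map (cube (Suc n)) (subtopology (powertop_real UNIV) (standard_simplex n))
    (cube_to_simplex n k)"
proof (clarsimp simp: continuous_map_in_subtopology continuous_map_componentwise Pi_iff
    cube_to_simplex_in[OF k])
  fix i
  let ?M = "\<lambda>x. max 1 (\<Sum>l\<in>{..n} - {k}. x l) :: real"
  have M: "continuous_map (cube (Suc n)) euclideanreal ?M"
    by (intro continuous_map_real_max continuous_map_sum continuous_map_cube_coord) auto
  have q: "continuous_map (cube (Suc n)) euclideanreal (\<lambda>x. x l / ?M x)" if "l \<le> n" for l
    using that by (intro continuous_map_real_divide M continuous_map_cube_coord) auto
  have "continuous_map (cube (Suc n)) euclideanreal (\<lambda>x. 1 - (\<Sum>l\<in>{..n} - {k}. x l / ?M x))"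
    by (intro continuous_map_diff continuous_map_sum q) auto
  then show "continuous_map (cube (Suc n)) euclideanreal (\<lambda>x. cube_to_simplex n k x i)"
    using q[of i] by (simp add: cube_to_simplex_def Let_def)
qed

lemma restrict_simplex_in_cube:
  "x \<in> standard_simplex n \<Longrightarrow> restrict x {..<Suc n} \<in> topspace (cube (Suc n))"
  by (simp add: in_topspace_cube standard_simplex_def)

lemma continuous_map_simplex_to_cube:
  "continuous_map (subtopology (powertop_real UNIV) (standard_simplex n)) (cube (Suc n))
     (\<lambda>x. restrict x {..<Suc n})"
proof (rule continuous_map_into_cube)
  show "continuous_map (subtopology (powertop_real UNIV) (standard_simplex n)) euclideanreal
      (\<lambda>x. restrict x {..<Suc n} i)" if "i < Suc n" for i
    using that continuous_map_from_subtopology[OF continuous_map_product_projection[of i UNIV "\<lambda>_. euclideanreal"]]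
    by simp
qed (auto intro: restrict_simplex_in_cube)

section \<open>Horns in the diagonal and their fillers\<close>

lemma horn_map_in_horn_set:
  assumes X: "simplicial_set X" and n: "1 \<le> n" "k \<le> n" and x: "x \<in> simplices X n"
  shows "horn_map (sface X) n k x \<in> horn_set X n k"
proof -
  have f: "sface X n i x \<in> simplices X (n - 1)" if "i \<le> n" for i
    using conjunct1[OF X[unfolded simplicial_set_def]] n x that by (auto simp: Pi_iff)
  have "sface X (n - 1) i (sface X n j x) = sface X (n - 1) (j - 1) (sface X n i x)"
    if "i < j" "j \<le> n" "i \<noteq> k" "j \<noteq> k" for i j
  proof -
    have "2 \<le> n" using that n by linarith
    then show ?thesis using X x that by (simp add: simplicial_set_def)
  qed
  then show ?thesis
    using f by (auto simp: horn_set_def horn_map_def horn_compatible_def)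
qed

lemma diag_horn_filler:
  assumes Z: "simplicial_space Z" and K: "topological_kan Z"
    and n: "1 \<le> n" "k \<le> n" and z: "z \<in> horn_set (diag (Sing_levelwise Z)) n k"
  obtains x where "x \<in> simplices (diag (Sing_levelwise Z)) n"
    and "horn_map (sface (diag (Sing_levelwise Z))) n k x = z"
proof -
  let ?X = "diag (Sing_levelwise Z)"
  let ?\<Delta> = "\<lambda>p. subtopology (powertop_real UNIV) (standard_simplex p)"
  let ?C = "cube (Suc n)"
  obtain p where p: "n = Suc p" using n by (cases n) auto
  have zs: "singular_simplex p (level Z p) (z i)" if "i \<le> n" "i \<noteq> k" for i
    using z that p by (auto simp: horn_set_def PiE_iff)
  have zext: "z \<in> extensional ({0..n} - {k})"
    using z by (simp add: horn_set_def PiE_iff)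
  have zc: "sface ?X p i (z j) = sface ?X p (j - 1) (z i)"
    if "i < j" "j \<le> n" "i \<noteq> k" "j \<noteq> k" for i j
    using z that p by (simp add: horn_set_def horn_compatible_def)
  let ?r = "cube_to_simplex n k"
  define D where "D i = cube_faces (Suc n) {i}" for i
  \<comment> \<open>For \<open>x\<close> in \<open>D i\<close> the point \<open>?r x\<close> lies on
    the \<open>i\<close>-th face of the simplex; deleting its zero coordinate gives the point at
    which \<open>z i\<close> prescribes \<open>d\<^sub>i \<sigma>\<close>.\<close>
  define s where "s i x = z i (simplicial_degen i (?r x))" for i x
  have D: "x \<in> topspace ?C" "x i = 0" if "x \<in> D i" for x i
    using that by (auto simp: D_def cube_faces_def)
  have r0: "?r x i = 0" if "x \<in> D i" "i \<noteq> k" for x i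
    using cube_to_simplex_zero D(2) that by blast
  have rin: "?r x \<in> standard_simplex (Suc p)" if "x \<in> D i" for x i
    using cube_to_simplex_in[OF n(2) D(1)[OF that]] p by simp
  \<comment> \<open>Nothing is prescribed for the filler itself, so the base is empty; this is
    allowed because \<open>n \<ge> 1\<close>.\<close>
  have "horn_data Z (Suc n) n k D s {} undefined"
    unfolding horn_data_def
  proof (intro conjI allI impI ballI)
    fix i assume i: "i \<le> n" "i \<noteq> k"
    show "cube_piece (Suc n) (D i)"
      using i unfolding cube_piece_def D_def by (intro disjI2 exI[of _ "{i}"]) auto
    have "(\<lambda>i\<in>{..<Suc n}. 0) \<in> D i"
      using i by (simp add: D_def cube_faces_def in_topspace_cube)
    then show "D i \<noteq> {}" by blast
    have "continuous_map (subtopology ?C (D i)) (powertop_real UNIV) ?r"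
      using continuous_map_cube_to_simplex[OF n(2)]
      by (intro continuous_map_from_subtopology) (simp add: continuous_map_in_subtopology)
    from continuous_map_compose[OF this continuous_map_simplicial_degen]
    have "continuous_map (subtopology ?C (D i)) (?\<Delta> p) (\<lambda>x. simplicial_degen i (?r x))"
      using simplicial_degen_zero_in_standard_simplex[OF rin _ r0] i p
      by (auto simp: continuous_map_in_subtopology o_def)
    moreover have "continuous_map (?\<Delta> p) (level Z p) (z i)"
      using zs[OF i] by (simp add: singular_simplex_def)
    ultimately show "continuous_map (subtopology ?C (D i)) (level Z (n - 1)) (s i)"
      using continuous_map_compose[of "subtopology ?C (D i)" "?\<Delta> p" _ "level Z p" "z i"] p
      by (simp add: s_def[abs_def] o_def)
  next
    fix i j x
    assume ij: "i < j" "j \<le> n" "i \<noteq> k" "j \<noteq> k" and x: "x \<in> D i \<inter> D j"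
    obtain q where q: "p = Suc q" using ij n p by (cases p) auto
    let ?y = "?r x"
    \<comment> \<open>With both vanishing coordinates deleted, the cofaces \<open>i\<close> and
      \<open>j - 1\<close> of \<open>?t\<close> are the arguments of \<open>z j\<close> and
      \<open>z i\<close>. Compatibility of the horn at \<open>?t\<close> is then the goal. The shift
      to \<open>j - 1\<close> arises because deleting coordinate \<open>i < j\<close> moves
      coordinate \<open>j\<close> down.\<close>
    let ?t = "simplicial_degen i (simplicial_degen j ?y)"
    have y0: "?y i = 0" "?y j = 0" using r0 x ij by auto
    have yj: "simplicial_degen j ?y \<in> standard_simplex p"
      using simplicial_degen_zero_in_standard_simplex[OF rin[of x j] _ y0(2)] x ij p by simp
    have e1: "simplical_face i ?t = simplicial_degen j ?y"
      using y0 ij by (intro simplical_face_degen_zero) (simp add: simplicial_degen_def)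
    have t2: "?t = simplicial_degen (j - 1) (simplicial_degen i ?y)"
      using simplicial_degen_degen[of i "j - 1" ?y] ij by simp
    have e2: "simplical_face (j - 1) ?t = simplicial_degen i ?y"
      unfolding t2 using y0 ij
      by (intro simplical_face_degen_zero) (auto simp: simplicial_degen_def)
    have t: "?t \<in> standard_simplex (p - 1)"
      using simplicial_degen_zero_in_standard_simplex[of "simplicial_degen j ?y" q i] yj y0 ij p q
      by (simp add: simplicial_degen_def)
    show "face Z (n - 1) i (s j x) = face Z (n - 1) (j - 1) (s i x)"
      using fun_cong[OF zc[OF ij], of ?t] t e1 e2 ij p q
      by (simp add: sface_diag_Sing s_def)
  qed (use n in \<open>auto simp: cube_piece_def cube_faces_def\<close>)
  from horn_filler_exists[OF Z K this] obtain \<tau>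
    where "horn_filler Z (Suc n) n k D s {} undefined \<tau>" by blast
  then have ct: "continuous_map ?C (level Z n) \<tau>"
    and tf: "\<And>i x. i \<le> n \<Longrightarrow> i \<noteq> k \<Longrightarrow> x \<in> D i \<Longrightarrow> face Z n i (\<tau> x) = s i x"
    by (auto simp: horn_filler_def)
  \<comment> \<open>The filler is pulled back along the inclusion of the simplex into the
    cube.\<close>
  define \<sigma> where "\<sigma> = (\<lambda>x\<in>standard_simplex n. \<tau> (restrict x {..<Suc n}))"
  have "continuous_map (?\<Delta> n) (level Z n) \<sigma>"
    using continuous_map_compose[OF continuous_map_simplex_to_cube ct]
    by (rule continuous_map_eq) (simp add: \<sigma>_def)
  then have \<sigma>: "\<sigma> \<in> simplices ?X n"
    by (simp add: singular_simplex_def \<sigma>_def)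
  have "sface ?X n i \<sigma> = z i" if i: "i \<le> n" "i \<noteq> k" for i
  proof
    fix t
    show "sface ?X n i \<sigma> t = z i t"
    proof (cases "t \<in> standard_simplex p")
      case False
      then show ?thesis
        using zs[OF i] n i p by (auto simp: sface_diag_Sing singular_simplex_def extensional_def)
    next
      case True
      let ?x = "simplical_face i t"
      have x: "?x \<in> standard_simplex n"
        using True n i p by (intro simplical_face_in_standard_simplex) auto
      have "restrict ?x {..<Suc n} \<in> D i"
        using restrict_simplex_in_cube[OF x] i
        by (simp add: D_def cube_faces_def simplical_face_def)
      \<comment> \<open>The retraction fixes \<open>?x\<close>, and the collapse undoes the coface,
        so the prescribed value is \<open>z i t\<close>.\<close>
      from tf[OF i this] have "face Z n i (\<tau> (restrict ?x {..<Suc n})) = z i t"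
        by (simp add: s_def cube_to_simplex_retract[OF n(2) x] simplicial_degen_face_same)
      then show ?thesis
        using True x n i p by (simp add: sface_diag_Sing \<sigma>_def)
    qed
  qed
  then have "horn_map (sface ?X) n k \<sigma> = z"
    using zext by (auto simp: horn_map_def fun_eq_iff extensional_def)
  with \<sigma> show thesis using that by blast
qed

theorem theorem4p4:
  fixes Z :: "'a sspace"
  assumes "simplicial_space Z"
    and "topological_kan Z"
  shows "kan_complex (diag (Sing_levelwise Z))"
  unfolding kan_complex_def
proof (intro conjI allI impI)
  let ?X = "diag (Sing_levelwise Z)"
  show X: "simplicial_set ?X" using assms(1) by (rule simplicial_set_diag_Sing)
  fix n k :: nat assume n: "1 \<le> n" "k \<le> n"
  show "horn_map (sface ?X) n k ` simplices ?X n = horn_set ?X n k"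
  proof
    show "horn_map (sface ?X) n k ` simplices ?X n \<subseteq> horn_set ?X n k"
      using horn_map_in_horn_set[OF X n] by (rule image_subsetI)
    show "horn_set ?X n k \<subseteq> horn_map (sface ?X) n k ` simplices ?X n"
      using diag_horn_filler[OF assms n] by (metis image_eqI subsetI)
  qed
qed

end
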